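(* Let $S$ be a semigroupoid and let $(\alpha,X)$ be a partial action of $S$ on a set $X$. Let $E$, ${_sE}$ and $\beta_s\colon {_sE}\to E$ ($s\in S$) be constructed from $(\alpha,X)$ as described in the context, let $\beta=(\{{_sE}\}_{s\in S},\{\beta_s\}_{s\in S})$, and define $\iota\colon X\to E$ by $\iota(x)=[\delta,x]$. Then: (i) The pair $(\beta,E)$ is a global action of $S$ on $E$. (ii) The triple $(\iota,\beta,E)$ is a universal globalization of $(\alpha,X)$.
   Context: A semigroupoid is a triple $(S,S^{(2)},\star)$ with $S$ a set, $S^{(2)}\subseteq S\times S$, and $\star\colon S^{(2)}\to S$, $(s,t)\mapsto st$, such that whenever $r,s,t\in S$ satisfy (i) $(s,t),(t,r)\in S^{(2)}$, or (ii) $(s,t),(st,r)\in S^{(2)}$, or (iii) $(t,r),(s,tr)\in S^{(2)}$, then all of $(s,t),(t,r),(st,r),(s,tr)$ lie in $S^{(2)}$ and $(st)r=s(tr)$. For $s\in S$: $S^s=\{t\in S: (s,t)\in S^{(2)}\}$, ${^sS}=\{t\in S:(t,s)\in S^{(2)}\}$. A partial action of $S$ on $X$ is a pair $\alpha=(\{{_sX}\}_{s\in S},\{\alpha_s\}_{s\in S})$ of subsets ${_sX}\subseteq X$ and functions $\alpha_s\colon {_sX}\to X$, with $X_s:=\alpha_s({_sX})$, such that for all $(s,t)\in S^{(2)}$: (P1) $\alpha_t^{-1}({_sX}\cap X_t)={_tX}\cap{_{st}X}$; (P2) $\alpha_s(\alpha_t(x))=\alpha_{st}(x)$ for all $x\in{_tX}\cap{_{st}X}$.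 It is denoted $(\alpha,X)$. It is a global action if moreover: (G1) $S^s=S^t\neq\emptyset$ implies ${_sX}={_tX}$; (G2) $(s,t)\in S^{(2)}$ implies ${_tX}={_{st}X}$. A morphism of partial actions $\varphi\colon(\alpha,X)\to(\beta,Y)$ is a function $\varphi\colon X\to Y$ such that for all $s\in S$: $\varphi({_sX})\subseteq{_sY}$ and $\varphi(\alpha_s(x))=\beta_s(\varphi(x))$ for all $x\in{_sX}$. It is an embedding if it is injective and ${_sX}=\{x\in X:\varphi(x)\in{_sY},\ \beta_s(\varphi(x))\in\varphi(X)\}$ for all $s\in S$. A globalization of $(\alpha,X)$ is a triple $(\iota,\beta,Y)$ with $(\beta,Y)$ a global action of $S$ and $\iota\colon(\alpha,X)\to(\beta,Y)$ an embedding. It is a universal globalization if for every global action $(\theta,Z)$ and morphism $\varphi\colon(\alpha,X)\to(\theta,Z)$ there is a unique morphism $\Phi\colon(\beta,Y)\to(\theta,Z)$ with $\Phi\circ\iota=\varphi$. Construction. For $s,t\in S$ write $s\sim t$ if $s=t$, or $S^s=S^t\neq\emptyset$, or there is $u\in{^tS}$ with $s=ut$. Let $R$ be the smallest equivalence relation on $S$ containing $\sim$, and $\rho_s$ the $R$-class of $s$. Put ${_{\rho_s}X}=\bigcup_{tRs}{_tX}\ \cup\ \bigcup_{t\in S^s}X_t$ (this depends only on $\rho_s$). Let $\delta$ be a symbol not in $S$, and let $D=\{(s,x)\in S\times X: x\in{_{\rho_s}X}\}\cup\{(\delta,x):x\in X\}$. Let $\approx$ be the smallest equivalence relation on $D$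 such that (1) $(\delta,y)\approx(s,x)$ whenever $s \in S$, $x\in{_sX}$ and $\alpha_s(x)=y$; (2) $(s,x)\approx(t,y)$ whenever $s,t\in S$ and there is $u\in S^t$ with $s=tu$, $x\in{_uX}$ and $\alpha_u(x)=y$. Let $E=D/{\approx}$, with the class of $(a,x)$ denoted $[a,x]$. For $s\in S$ let ${_sD}=\{(a,x)\in D:(a,x)\approx(t,y)\text{ for some }(t,y)\in D\text{ with }t\in S^s\}\cup\{(\delta,x):x\in{_{\rho_s}X}\}$, and let ${_sE}\subseteq E$ be the set of classes of elements of ${_sD}$. Define $\beta_s\colon{_sE}\to E$ by $\beta_s([a,x])=[st,y]$ if $(a,x)\approx(t,y)$ with $t\in S^s$, and $\beta_s([\delta,x])=[s,x]$ if $x\in{_{\rho_s}X}$ (this is well defined). *)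

theory Defs
  imports "HOL-Library.FuncSet"
begin

section \<open>Semigroupoids\<close>

record 's sgpd =
  elems :: "'s set"
  comps :: "('s \<times> 's) set"
  star :: "'s \<Rightarrow> 's \<Rightarrow> 's"

definition semigroupoid :: "'s sgpd \<Rightarrow> bool" where
  "semigroupoid S \<longleftrightarrow>
     comps S \<subseteq> elems S \<times> elems S \<and>
     (\<forall>(s, t) \<in> comps S. star S s t \<in> elems S) \<and>
     (\<forall>r \<in> elems S. \<forall>s \<in> elems S. \<forall>t \<in> elems S.
        ((s, t) \<in> comps S \<and> (t, r) \<in> comps S) \<or>
        ((s, t) \<in> comps S \<and> (star S s t, r) \<in> comps S) \<or>
        ((t, r) \<in> comps S \<and> (s, star S t r) \<in> comps S) \<longrightarrow>
        (s, t) \<in> comps S \<and> (t, r) \<in> comps S \<and>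
        (star S s t, r) \<in> comps S \<and> (s, star S t r) \<in> comps S \<and>
        star S (star S s t) r = star S s (star S t r))"

text \<open>\<open>after S s\<close> is $S^s$ and \<open>before S s\<close> is ${}^sS$.\<close>

definition after :: "'s sgpd \<Rightarrow> 's \<Rightarrow> 's set" where
  "after S s = {t \<in> elems S. (s, t) \<in> comps S}"

definition before :: "'s sgpd \<Rightarrow> 's \<Rightarrow> 's set" where
  "before S s = {t \<in> elems S. (t, s) \<in> comps S}"


section \<open>Partial and global actions\<close>

text \<open>\<open>pdom \<alpha> s\<close> is ${}_sX$ and \<open>pact \<alpha> s\<close> is $\alpha_s$. Only the values of \<open>pdom \<alpha> s\<close>
  for \<open>s \<in> elems S\<close>, and those of \<open>pact \<alpha> s\<close> on \<open>pdom \<alpha> s\<close> for such \<open>s\<close>, are relevant.\<close>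

record ('s, 'x) action =
  pdom :: "'s \<Rightarrow> 'x set"
  pact :: "'s \<Rightarrow> 'x \<Rightarrow> 'x"

text \<open>The set $X_s$.\<close>

definition prange :: "('s, 'x) action \<Rightarrow> 's \<Rightarrow> 'x set" where
  "prange \<alpha> s = pact \<alpha> s ` pdom \<alpha> s"

definition partial_action :: "'s sgpd \<Rightarrow> ('s, 'x) action \<Rightarrow> 'x set \<Rightarrow> bool" where
  "partial_action S \<alpha> X \<longleftrightarrow>
     (\<forall>s \<in> elems S. pdom \<alpha> s \<subseteq> X \<and> pact \<alpha> s \<in> pdom \<alpha> s \<rightarrow> X) \<and>
     (\<forall>(s, t) \<in> comps S.
        {x \<in> pdom \<alpha> t. pact \<alpha> t x \<in> pdom \<alpha> s \<inter> prange \<alpha> t} = pdom \<alpha> t \<inter> pdom \<alpha> (star S s t) \<and>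
        (\<forall>x \<in> pdom \<alpha> t \<inter> pdom \<alpha> (star S s t).
           pact \<alpha> s (pact \<alpha> t x) = pact \<alpha> (star S s t) x))"

definition global_action :: "'s sgpd \<Rightarrow> ('s, 'x) action \<Rightarrow> 'x set \<Rightarrow> bool" where
  "global_action S \<alpha> X \<longleftrightarrow>
     partial_action S \<alpha> X \<and>
     (\<forall>s \<in> elems S. \<forall>t \<in> elems S.
        after S s = after S t \<and> after S s \<noteq> {} \<longrightarrow> pdom \<alpha> s = pdom \<alpha> t) \<and>
     (\<forall>(s, t) \<in> comps S. pdom \<alpha> t = pdom \<alpha> (star S s t))"

definition action_morphism ::
  "'s sgpd \<Rightarrow> ('s, 'x) action \<Rightarrow> 'x set \<Rightarrow> ('s, 'y) action \<Rightarrow> 'y set \<Rightarrow> ('x \<Rightarrow> 'y) \<Rightarrow> bool" where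
  "action_morphism S \<alpha> X \<beta> Y \<phi> \<longleftrightarrow>
     \<phi> \<in> X \<rightarrow> Y \<and>
     (\<forall>s \<in> elems S.
        \<phi> ` pdom \<alpha> s \<subseteq> pdom \<beta> s \<and>
        (\<forall>x \<in> pdom \<alpha> s. \<phi> (pact \<alpha> s x) = pact \<beta> s (\<phi> x)))"

definition action_embedding ::
  "'s sgpd \<Rightarrow> ('s, 'x) action \<Rightarrow> 'x set \<Rightarrow> ('s, 'y) action \<Rightarrow> 'y set \<Rightarrow> ('x \<Rightarrow> 'y) \<Rightarrow> bool" where
  "action_embedding S \<alpha> X \<beta> Y \<phi> \<longleftrightarrow>
     action_morphism S \<alpha> X \<beta> Y \<phi> \<and>
     inj_on \<phi> X \<and>
     (\<forall>s \<in> elems S. pdom \<alpha> s = {x \<in> X. \<phi> x \<in> pdom \<beta> s \<and> pact \<beta> s (\<phi> x) \<in> \<phi> ` X})"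

definition globalization ::
  "'s sgpd \<Rightarrow> ('s, 'x) action \<Rightarrow> 'x set \<Rightarrow> ('x \<Rightarrow> 'y) \<Rightarrow> ('s, 'y) action \<Rightarrow> 'y set \<Rightarrow> bool" where
  "globalization S \<alpha> X \<iota> \<beta> Y \<longleftrightarrow>
     global_action S \<beta> Y \<and> action_embedding S \<alpha> X \<beta> Y \<iota>"

text \<open>A formula of HOL cannot quantify over the type in which the test actions live, so that
  type is a parameter; a theorem in which it is a type variable covers all of them. A function
  $Y \to Z$ is represented by its unique representative in \<open>extensional Y\<close>, which makes
  \<open>\<exists>!\<close> express uniqueness as a function on \<open>Y\<close>.\<close>

definition universal_globalization ::
  "'z itself \<Rightarrow> 's sgpd \<Rightarrow> ('s, 'x) action \<Rightarrow> 'x set \<Rightarrow>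
     ('x \<Rightarrow> 'y) \<Rightarrow> ('s, 'y) action \<Rightarrow> 'y set \<Rightarrow> bool" where
  "universal_globalization T S \<alpha> X \<iota> \<beta> Y \<longleftrightarrow>
     globalization S \<alpha> X \<iota> \<beta> Y \<and>
     (\<forall>(\<theta> :: ('s, 'z) action) (Z :: 'z set) \<phi>.
        global_action S \<theta> Z \<and> action_morphism S \<alpha> X \<theta> Z \<phi> \<longrightarrow>
        (\<exists>!\<Phi>. \<Phi> \<in> extensional Y \<and> action_morphism S \<beta> Y \<theta> Z \<Phi> \<and>
              (\<forall>x \<in> X. \<Phi> (\<iota> x) = \<phi> x)))"


section \<open>The construction\<close>

definition equiv_closure :: "'a set \<Rightarrow> ('a \<times> 'a) set \<Rightarrow> ('a \<times> 'a) set" where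
  "equiv_closure A r = \<Inter> {Q. equiv A Q \<and> r \<subseteq> Q}"

definition sim_rel :: "'s sgpd \<Rightarrow> ('s \<times> 's) set" where
  "sim_rel S = {(s, t). s \<in> elems S \<and> t \<in> elems S \<and>
     (s = t \<or> (after S s = after S t \<and> after S s \<noteq> {}) \<or> (\<exists>u \<in> before S t. s = star S u t))}"

definition R_rel :: "'s sgpd \<Rightarrow> ('s \<times> 's) set" where
  "R_rel S = equiv_closure (elems S) (sim_rel S)"

text \<open>The set ${}_{\rho_s}X$.\<close>

definition rhoX :: "'s sgpd \<Rightarrow> ('s, 'x) action \<Rightarrow> 's \<Rightarrow> 'x set" where
  "rhoX S \<alpha> s = (\<Union>t \<in> {t. (t, s) \<in> R_rel S}. pdom \<alpha> t) \<union> (\<Union>t \<in> after S s. prange \<alpha> t)"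

text \<open>The symbol $\delta$ is \<open>None\<close>, and \<open>Some s\<close> stands for \<open>s\<close>.\<close>

definition Dset :: "'s sgpd \<Rightarrow> ('s, 'x) action \<Rightarrow> 'x set \<Rightarrow> ('s option \<times> 'x) set" where
  "Dset S \<alpha> X = {(Some s, x) | s x. s \<in> elems S \<and> x \<in> X \<and> x \<in> rhoX S \<alpha> s} \<union>
                {(None, x) | x. x \<in> X}"

definition Dgen :: "'s sgpd \<Rightarrow> ('s, 'x) action \<Rightarrow> (('s option \<times> 'x) \<times> ('s option \<times> 'x)) set" where
  "Dgen S \<alpha> =
     {((None, y), (Some s, x)) | s x y. s \<in> elems S \<and> x \<in> pdom \<alpha> s \<and> pact \<alpha> s x = y} \<union>
     {((Some s, x), (Some t, y)) | s t x y. s \<in> elems S \<and> t \<in> elems S \<and>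
        (\<exists>u \<in> after S t. s = star S t u \<and> x \<in> pdom \<alpha> u \<and> pact \<alpha> u x = y)}"

definition Deq ::
  "'s sgpd \<Rightarrow> ('s, 'x) action \<Rightarrow> 'x set \<Rightarrow> (('s option \<times> 'x) \<times> ('s option \<times> 'x)) set" where
  "Deq S \<alpha> X = equiv_closure (Dset S \<alpha> X) (Dgen S \<alpha>)"

definition Ecls ::
  "'s sgpd \<Rightarrow> ('s, 'x) action \<Rightarrow> 'x set \<Rightarrow> 's option \<times> 'x \<Rightarrow> ('s option \<times> 'x) set" where
  "Ecls S \<alpha> X p = Deq S \<alpha> X `` {p}"

definition Eset :: "'s sgpd \<Rightarrow> ('s, 'x) action \<Rightarrow> 'x set \<Rightarrow> ('s option \<times> 'x) set set" where
  "Eset S \<alpha> X = Dset S \<alpha> X // Deq S \<alpha> X"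

definition Ddom :: "'s sgpd \<Rightarrow> ('s, 'x) action \<Rightarrow> 'x set \<Rightarrow> 's \<Rightarrow> ('s option \<times> 'x) set" where
  "Ddom S \<alpha> X s =
     {p \<in> Dset S \<alpha> X. \<exists>t y. (Some t, y) \<in> Dset S \<alpha> X \<and> t \<in> after S s \<and>
                            (p, (Some t, y)) \<in> Deq S \<alpha> X} \<union>
     {(None, x) | x. x \<in> rhoX S \<alpha> s}"

definition Edom :: "'s sgpd \<Rightarrow> ('s, 'x) action \<Rightarrow> 'x set \<Rightarrow> 's \<Rightarrow> ('s option \<times> 'x) set set" where
  "Edom S \<alpha> X s = Ecls S \<alpha> X ` Ddom S \<alpha> X s"

text \<open>The two clauses relate a class to every value they prescribe for it; the definite
  description is meaningful because the value is unique.\<close>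

definition Eact ::
  "'s sgpd \<Rightarrow> ('s, 'x) action \<Rightarrow> 'x set \<Rightarrow> 's \<Rightarrow> ('s option \<times> 'x) set \<Rightarrow> ('s option \<times> 'x) set" where
  "Eact S \<alpha> X s e = (THE e'.
     (\<exists>p t y. p \<in> Dset S \<alpha> X \<and> e = Ecls S \<alpha> X p \<and>
        (Some t, y) \<in> Dset S \<alpha> X \<and> (p, (Some t, y)) \<in> Deq S \<alpha> X \<and> t \<in> after S s \<and>
        e' = Ecls S \<alpha> X (Some (star S s t), y)) \<or>
     (\<exists>x \<in> rhoX S \<alpha> s. e = Ecls S \<alpha> X (None, x) \<and> e' = Ecls S \<alpha> X (Some s, x)))"

definition Eaction :: "'s sgpd \<Rightarrow> ('s, 'x) action \<Rightarrow> 'x set \<Rightarrow> ('s, ('s option \<times> 'x) set) action" where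
  "Eaction S \<alpha> X = \<lparr>pdom = Edom S \<alpha> X, pact = Eact S \<alpha> X\<rparr>"

definition iota :: "'s sgpd \<Rightarrow> ('s, 'x) action \<Rightarrow> 'x set \<Rightarrow> 'x \<Rightarrow> ('s option \<times> 'x) set" where
  "iota S \<alpha> X x = Ecls S \<alpha> X (None, x)"

end

theory Submission
  imports Defs
begin

text \<open>Everything rests on two functions that are constant on the classes of \<open>\<approx>\<close>. The first sends
  \<open>(\<delta>, z)\<close> to \<open>z\<close>, and \<open>(s, x)\<close> to \<open>\<alpha>\<^sub>s(x)\<close> where this is defined. By (P1) and (P2) it respects both
  generating relations, so it recovers \<open>z\<close> from \<open>[\<delta>, z]\<close>; this makes \<open>\<iota>\<close> an embedding. The second
  computes \<open>\<beta>\<^sub>s\<close> on representatives. It reads off the value at \<open>\<delta>\<close> whenever the first function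
  is defined; the classes left over contain no \<open>(\<delta>, z)\<close> and are linked by relation (2) only, where
  the semigroupoid axioms apply. Since the set \<open>S\<^sup>s\<close> and, for a global action, the domain of \<open>s\<close> depend
  only on the class \<open>\<rho>\<^sub>s\<close>, the action axioms and universality then reduce to \<open>[s, x] = \<beta>\<^sub>s([\<delta>, x])\<close>.\<close>

section \<open>Smallest equivalence relations\<close>

lemma equiv_equiv_closure:
  assumes "r \<subseteq> A \<times> A"
  shows "equiv A (equiv_closure A r)"
proof -
  \<comment> \<open>The total relation belongs to the intersected family; hence the family is
    nonempty and its intersection stays inside \<open>A \<times> A\<close>.\<close>
  have "equiv A (A \<times> A)"
    by (auto simp: equiv_def refl_on_def sym_def trans_def)
  then have "equiv_closure A r \<subseteq> A \<times> A"
    using assms by (auto simp: equiv_closure_def)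
  then show ?thesis
  proof (rule equivI)
    show "refl_on A (equiv_closure A r)"
      by (auto simp: equiv_closure_def equiv_def refl_on_def)
    show "sym (equiv_closure A r)"
      unfolding equiv_closure_def sym_def by (blast elim: equivE dest: symD)
    show "trans (equiv_closure A r)"
      unfolding equiv_closure_def trans_def by (blast elim: equivE dest: transD)
  qed
qed

text \<open>Every relation in the intersected family contains \<open>r\<close>. Used to place the
  generating pairs in \<open>R_rel\<close> and \<open>Deq\<close>.\<close>

lemma equiv_closure_increasing: "r \<subseteq> equiv_closure A r"
  by (auto simp: equiv_closure_def)

text \<open>The kernel of \<open>f\<close> on \<open>A\<close> is an equivalence relation containing
  \<open>r\<close>, so it contains the closure. This replaces induction along chains: to separate
  two classes it suffices to find an \<open>f\<close> that respects the generators.\<close>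

lemma equiv_closure_invariant:
  assumes "r \<subseteq> A \<times> A" and "(x, y) \<in> equiv_closure A r"
    and "\<And>x y. (x, y) \<in> r \<Longrightarrow> f x = f y"
  shows "f x = f y"
proof -
  let ?Q = "{(x, y). x \<in> A \<and> y \<in> A \<and> f x = f y}"
  have "equiv A ?Q"
    by (auto simp: equiv_def refl_on_def sym_def trans_def)
  moreover have "r \<subseteq> ?Q"
    using assms by auto
  ultimately have "equiv_closure A r \<subseteq> ?Q"
    by (auto simp: equiv_closure_def)
  then show ?thesis
    using assms(2) by auto
qed

section \<open>Pointwise form of the action and morphism axioms\<close>

lemma partial_actionD:
  assumes "partial_action S \<alpha> X"
  shows pdom_subset: "s \<in> elems S \<Longrightarrow> x \<in> pdom \<alpha> s \<Longrightarrow> x \<in> X"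
    and pact_closed: "s \<in> elems S \<Longrightarrow> x \<in> pdom \<alpha> s \<Longrightarrow> pact \<alpha> s x \<in> X"
    and pact_mem_pdom_iff: "(s, t) \<in> comps S \<Longrightarrow> x \<in> pdom \<alpha> t \<Longrightarrow>
      pact \<alpha> t x \<in> pdom \<alpha> s \<longleftrightarrow> x \<in> pdom \<alpha> (star S s t)"
    and pact_pact: "(s, t) \<in> comps S \<Longrightarrow> x \<in> pdom \<alpha> t \<Longrightarrow> x \<in> pdom \<alpha> (star S s t) \<Longrightarrow>
      pact \<alpha> s (pact \<alpha> t x) = pact \<alpha> (star S s t) x"
proof -
  show "s \<in> elems S \<Longrightarrow> x \<in> pdom \<alpha> s \<Longrightarrow> x \<in> X"
    "s \<in> elems S \<Longrightarrow> x \<in> pdom \<alpha> s \<Longrightarrow> pact \<alpha> s x \<in> X"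
    using assms by (auto simp: partial_action_def)
next
  assume st: "(s, t) \<in> comps S" and x: "x \<in> pdom \<alpha> t"
  have eq: "{x \<in> pdom \<alpha> t. pact \<alpha> t x \<in> pdom \<alpha> s \<inter> prange \<alpha> t} = pdom \<alpha> t \<inter> pdom \<alpha> (star S s t)"
    and act: "\<forall>x \<in> pdom \<alpha> t \<inter> pdom \<alpha> (star S s t). pact \<alpha> s (pact \<alpha> t x) = pact \<alpha> (star S s t) x"
    using assms st by (auto simp: partial_action_def)
  have "x \<in> {x \<in> pdom \<alpha> t. pact \<alpha> t x \<in> pdom \<alpha> s \<inter> prange \<alpha> t} \<longleftrightarrow>
      x \<in> pdom \<alpha> t \<inter> pdom \<alpha> (star S s t)"
    by (simp only: eq)
  with x show "pact \<alpha> t x \<in> pdom \<alpha> s \<longleftrightarrow> x \<in> pdom \<alpha> (star S s t)"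
    by (auto simp: prange_def)
  show "x \<in> pdom \<alpha> (star S s t) \<Longrightarrow> pact \<alpha> s (pact \<alpha> t x) = pact \<alpha> (star S s t) x"
    using act x by blast
qed

lemma action_morphismD:
  assumes "action_morphism S \<alpha> X \<beta> Y \<phi>"
  shows morphism_closed: "x \<in> X \<Longrightarrow> \<phi> x \<in> Y"
    and morphism_pdom: "s \<in> elems S \<Longrightarrow> x \<in> pdom \<alpha> s \<Longrightarrow> \<phi> x \<in> pdom \<beta> s"
    and morphism_pact: "s \<in> elems S \<Longrightarrow> x \<in> pdom \<alpha> s \<Longrightarrow> \<phi> (pact \<alpha> s x) = pact \<beta> s (\<phi> x)"
  using assms by (auto simp: action_morphism_def)

lemma global_action_imp_partial_action: "global_action S \<theta> Z \<Longrightarrow> partial_action S \<theta> Z"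
  by (simp add: global_action_def)

section \<open>Semigroupoids, the relation R, and global actions\<close>

locale sgpd =
  fixes S :: "'s sgpd"
  assumes semigroupoid: "semigroupoid S"
begin

lemma comps_elems:
  assumes "(s, t) \<in> comps S"
  shows "s \<in> elems S" "t \<in> elems S" "star S s t \<in> elems S"
  using semigroupoid assms by (auto simp: semigroupoid_def)

lemma semigroupoidD:
  assumes "r \<in> elems S" "s \<in> elems S" "t \<in> elems S"
    and "(s, t) \<in> comps S \<and> (t, r) \<in> comps S \<or> (s, t) \<in> comps S \<and> (star S s t, r) \<in> comps S \<or>
      (t, r) \<in> comps S \<and> (s, star S t r) \<in> comps S"
  shows "(s, t) \<in> comps S \<and> (t, r) \<in> comps S \<and>
    (star S s t, r) \<in> comps S \<and> (s, star S t r) \<in> comps S \<and>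
    star S (star S s t) r = star S s (star S t r)"
  using semigroupoid assms unfolding semigroupoid_def by blast

text \<open>The second disjunct in \<open>semigroupoidD\<close> gives one direction, the first
  disjunct the other. The mirror image below uses the third and the first.\<close>

lemma comps_star_left_iff: "(s, t) \<in> comps S \<Longrightarrow> (star S s t, r) \<in> comps S \<longleftrightarrow> (t, r) \<in> comps S"
  using semigroupoidD comps_elems by meson

lemma comps_star_right_iff: "(t, r) \<in> comps S \<Longrightarrow> (s, star S t r) \<in> comps S \<longleftrightarrow> (s, t) \<in> comps S"
  using semigroupoidD comps_elems by meson

lemma star_assoc:
  "(s, t) \<in> comps S \<Longrightarrow> (t, r) \<in> comps S \<Longrightarrow> star S (star S s t) r = star S s (star S t r)"
  using semigroupoidD comps_elems by meson

lemma mem_after_iff: "t \<in> after S s \<longleftrightarrow> (s, t) \<in> comps S"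
  using comps_elems by (auto simp: after_def)

lemma after_star: "(s, t) \<in> comps S \<Longrightarrow> after S (star S s t) = after S t"
  by (auto simp: mem_after_iff comps_star_left_iff)

lemma sim_rel_subset: "sim_rel S \<subseteq> elems S \<times> elems S"
  by (auto simp: sim_rel_def)

lemma equiv_R_rel: "equiv (elems S) (R_rel S)"
  unfolding R_rel_def by (rule equiv_equiv_closure[OF sim_rel_subset])

lemma sim_rel_invariant_imp_R_rel_invariant:
  assumes "(s, t) \<in> R_rel S" and "\<And>s t. (s, t) \<in> sim_rel S \<Longrightarrow> f s = f t"
  shows "f s = f t"
  using assms equiv_closure_invariant[OF sim_rel_subset] unfolding R_rel_def by metis

text \<open>It suffices to check the generators: the middle clause of \<open>sim_rel\<close> asserts
  the equality outright, and the last one is \<open>after_star\<close>.\<close>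

lemma R_rel_after:
  assumes "(s, t) \<in> R_rel S"
  shows "after S s = after S t"
  using assms
  by (rule sim_rel_invariant_imp_R_rel_invariant)
    (auto simp: sim_rel_def before_def after_star)

lemma R_rel_star:
  assumes "(s, t) \<in> comps S"
  shows "(star S s t, t) \<in> R_rel S"
proof -
  have "(star S s t, t) \<in> sim_rel S"
    using comps_elems[OF assms] assms by (auto simp: sim_rel_def before_def)
  then show ?thesis
    using equiv_closure_increasing by (auto simp: R_rel_def)
qed

lemma R_rel_of_after_eq:
  assumes "s \<in> elems S" "t \<in> elems S" "after S s = after S t" "after S s \<noteq> {}"
  shows "(s, t) \<in> R_rel S"
proof -
  have "(s, t) \<in> sim_rel S"
    using assms by (auto simp: sim_rel_def)
  then show ?thesis
    using equiv_closure_increasing by (auto simp: R_rel_def)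
qed

lemma global_action_pdom_star:
  assumes "global_action S \<theta> Z" "(s, t) \<in> comps S"
  shows "pdom \<theta> (star S s t) = pdom \<theta> t"
  using assms by (auto simp: global_action_def)

text \<open>The nontrivial clauses of \<open>sim_rel\<close> are exactly the situations in which
  (G1) and (G2) force equal domains.\<close>

lemma global_action_R_rel_pdom:
  assumes "global_action S \<theta> Z" and "(s, t) \<in> R_rel S"
  shows "pdom \<theta> s = pdom \<theta> t"
  using assms(2)
proof (rule sim_rel_invariant_imp_R_rel_invariant)
  fix s t
  assume "(s, t) \<in> sim_rel S"
  then show "pdom \<theta> s = pdom \<theta> t"
    using assms(1) global_action_pdom_star[OF assms(1)]
    unfolding sim_rel_def before_def global_action_def by blast
qed

text \<open>By (G2) the right-hand side of (P1) is all of \<open>pdom \<theta> t\<close>, so no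
  further condition on \<open>z\<close> remains.\<close>

lemma global_action_pact_mem:
  assumes "global_action S \<theta> Z" "(s, t) \<in> comps S" "z \<in> pdom \<theta> t"
  shows "pact \<theta> t z \<in> pdom \<theta> s"
  using assms pact_mem_pdom_iff global_action_imp_partial_action global_action_pdom_star by metis

lemma global_action_pact_star:
  assumes "global_action S \<theta> Z" "(s, t) \<in> comps S" "z \<in> pdom \<theta> t"
  shows "pact \<theta> (star S s t) z = pact \<theta> s (pact \<theta> t z)"
  using assms pact_pact global_action_imp_partial_action global_action_pdom_star by metis

end

section \<open>The set D and the relation generated on it\<close>

locale partial_sgpd_action = sgpd S for S :: "'s sgpd" +
  fixes \<alpha> :: "('s, 'x) action" and X :: "'x set"
  assumes partial_action: "partial_action S \<alpha> X"
begin

abbreviation D where "D \<equiv> Dset S \<alpha> X"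
abbreviation cls where "cls \<equiv> Ecls S \<alpha> X"

lemma rhoX_R_rel:
  assumes "(s, t) \<in> R_rel S"
  shows "rhoX S \<alpha> s = rhoX S \<alpha> t"
proof -
  have "(r, s) \<in> R_rel S \<longleftrightarrow> (r, t) \<in> R_rel S" for r
    using assms equiv_R_rel by (meson equiv_def symD transD)
  then show ?thesis
    using R_rel_after[OF assms] by (simp add: rhoX_def)
qed

lemma rhoX_star: "(s, t) \<in> comps S \<Longrightarrow> rhoX S \<alpha> (star S s t) = rhoX S \<alpha> t"
  by (rule rhoX_R_rel[OF R_rel_star])

lemma pdom_subset_rhoX: "s \<in> elems S \<Longrightarrow> x \<in> pdom \<alpha> s \<Longrightarrow> x \<in> rhoX S \<alpha> s"
  using equiv_R_rel by (auto simp: rhoX_def equiv_def refl_on_def)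

lemma pact_mem_rhoX: "(s, t) \<in> comps S \<Longrightarrow> x \<in> pdom \<alpha> t \<Longrightarrow> pact \<alpha> t x \<in> rhoX S \<alpha> s"
  by (auto simp: rhoX_def prange_def mem_after_iff)

lemma rhoX_subset: "x \<in> rhoX S \<alpha> s \<Longrightarrow> x \<in> X"
  using pdom_subset[OF partial_action] pact_closed[OF partial_action] equiv_type[OF equiv_R_rel]
  by (auto simp: rhoX_def prange_def after_def)

lemma None_mem_D [simp]: "(None, x) \<in> D \<longleftrightarrow> x \<in> X"
  by (auto simp: Dset_def)

lemma Some_mem_D [simp]: "(Some s, x) \<in> D \<longleftrightarrow> s \<in> elems S \<and> x \<in> rhoX S \<alpha> s"
  by (auto simp: Dset_def intro: rhoX_subset)

lemma star_mem_D: "(s, t) \<in> comps S \<Longrightarrow> (Some t, y) \<in> D \<Longrightarrow> (Some (star S s t), y) \<in> D"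
  by (auto simp: rhoX_star comps_elems)

lemma Dgen_cases [consumes 1, case_names delta star]:
  assumes "(p, q) \<in> Dgen S \<alpha>"
  obtains s x where "p = (None, pact \<alpha> s x)" "q = (Some s, x)" "s \<in> elems S" "x \<in> pdom \<alpha> s"
  | t u x where "p = (Some (star S t u), x)" "q = (Some t, pact \<alpha> u x)"
      "(t, u) \<in> comps S" "x \<in> pdom \<alpha> u"
  using assms by (auto simp: Dgen_def mem_after_iff)

text \<open>Here both unions in \<open>rhoX\<close> are used: \<open>(Some (star S t u), x)\<close>
  lies in \<open>D\<close> because \<open>star S t u\<close> and \<open>u\<close> are R-related and
  \<open>x \<in> pdom \<alpha> u\<close>, and \<open>(Some t, pact \<alpha> u x)\<close> because
  \<open>pact \<alpha> u x\<close> lies in the range of some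
  \<open>u \<in> after S t\<close>.\<close>

lemma Dgen_subset: "Dgen S \<alpha> \<subseteq> D \<times> D"
proof (rule subrelI)
  fix p q
  assume "(p, q) \<in> Dgen S \<alpha>"
  then have "p \<in> D \<and> q \<in> D"
  proof (cases rule: Dgen_cases)
    case (delta s x)
    then show ?thesis
      using pact_closed[OF partial_action] pdom_subset_rhoX by simp
  next
    case (star t u x)
    have "t \<in> elems S" "u \<in> elems S" "star S t u \<in> elems S"
      using comps_elems[OF star(3)] by simp_all
    then show ?thesis
      using star rhoX_star[OF star(3)] pdom_subset_rhoX pact_mem_rhoX by simp
  qed
  then show "(p, q) \<in> D \<times> D" by simp
qed

lemma equiv_Deq: "equiv D (Deq S \<alpha> X)"
  unfolding Deq_def by (rule equiv_equiv_closure[OF Dgen_subset])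

lemma Dgen_invariant_imp_Deq_invariant:
  assumes "(p, q) \<in> Deq S \<alpha> X" and "\<And>p q. (p, q) \<in> Dgen S \<alpha> \<Longrightarrow> f p = f q"
  shows "f p = f q"
  using assms equiv_closure_invariant[OF Dgen_subset] unfolding Deq_def by metis

lemma Deq_mem_D: "(p, q) \<in> Deq S \<alpha> X \<Longrightarrow> p \<in> D \<and> q \<in> D"
  using equiv_Deq by (auto simp: equiv_def refl_on_def)

lemma cls_eq_iff: "p \<in> D \<Longrightarrow> q \<in> D \<Longrightarrow> cls p = cls q \<longleftrightarrow> (p, q) \<in> Deq S \<alpha> X"
  unfolding Ecls_def using equiv_Deq eq_equiv_class_iff by metis

lemma cls_eqI: "(p, q) \<in> Deq S \<alpha> X \<Longrightarrow> cls p = cls q"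
  unfolding Ecls_def using equiv_Deq equiv_class_eq by metis

lemma Eset_eq: "Eset S \<alpha> X = cls ` D"
  by (auto simp: Eset_def Ecls_def quotient_def)

lemma cls_mem_Eset: "p \<in> D \<Longrightarrow> cls p \<in> Eset S \<alpha> X"
  by (simp add: Eset_eq)

lemma Deq_delta: "s \<in> elems S \<Longrightarrow> x \<in> pdom \<alpha> s \<Longrightarrow> ((None, pact \<alpha> s x), (Some s, x)) \<in> Deq S \<alpha> X"
  using equiv_closure_increasing[of "Dgen S \<alpha>" D] by (auto simp: Deq_def Dgen_def)

lemma Deq_star:
  assumes "(t, u) \<in> comps S" "x \<in> pdom \<alpha> u"
  shows "((Some (star S t u), x), (Some t, pact \<alpha> u x)) \<in> Deq S \<alpha> X"
proof -
  have "((Some (star S t u), x), (Some t, pact \<alpha> u x)) \<in> Dgen S \<alpha>"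
    using assms comps_elems[OF assms(1)] by (auto simp: Dgen_def mem_after_iff)
  then show ?thesis
    using equiv_closure_increasing by (auto simp: Deq_def)
qed

section \<open>Two functions constant on classes\<close>

fun delta_val :: "'s option \<times> 'x \<Rightarrow> 'x option" where
  "delta_val (None, z) = Some z"
| "delta_val (Some s, x) = (if x \<in> pdom \<alpha> s then Some (pact \<alpha> s x) else None)"

text \<open>(P1) says that the two sides are defined simultaneously, (P2) that their values
  agree.\<close>

lemma delta_val_star:
  assumes "(t, u) \<in> comps S" "x \<in> pdom \<alpha> u"
  shows "delta_val (Some (star S t u), x) = delta_val (Some t, pact \<alpha> u x)"
  using assms pact_mem_pdom_iff[OF partial_action] pact_pact[OF partial_action] by simp

lemma delta_val_Deq: "(p, q) \<in> Deq S \<alpha> X \<Longrightarrow> delta_val p = delta_val q"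
proof (erule Dgen_invariant_imp_Deq_invariant)
  fix p q
  assume "(p, q) \<in> Dgen S \<alpha>"
  then show "delta_val p = delta_val q"
    by (cases rule: Dgen_cases) (simp_all add: delta_val_star del: delta_val.simps(2), simp)
qed

text \<open>The branching is on \<open>delta_val p\<close> before \<open>fst p\<close>, since
  relation (1) links pairs with different kinds of first component. The value \<open>None\<close>
  means that nothing is prescribed.\<close>

definition act_val :: "'s \<Rightarrow> 's option \<times> 'x \<Rightarrow> ('s option \<times> 'x) set option" where
  "act_val s p = (case delta_val p of
     Some z \<Rightarrow> if z \<in> rhoX S \<alpha> s then Some (cls (Some s, z)) else None
   | None \<Rightarrow> (case fst p of
       Some t \<Rightarrow> if (s, t) \<in> comps S then Some (cls (Some (star S s t), snd p)) else None
     | None \<Rightarrow> None))"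

lemma act_val_None [simp]:
  "act_val s (None, x) = (if x \<in> rhoX S \<alpha> s then Some (cls (Some s, x)) else None)"
  by (simp add: act_val_def)

text \<open>If \<open>y \<in> pdom \<alpha> t\<close>, the definition yields the class of
  \<open>(Some s, pact \<alpha> t y)\<close> instead, and relation (2) identifies it with the class
  of \<open>(Some (star S s t), y)\<close>.\<close>

lemma act_val_Some:
  assumes "(s, t) \<in> comps S"
  shows "act_val s (Some t, y) = Some (cls (Some (star S s t), y))"
  using assms cls_eqI[OF Deq_star] pact_mem_rhoX by (simp add: act_val_def)

lemma act_val_Deq: "(p, q) \<in> Deq S \<alpha> X \<Longrightarrow> act_val s p = act_val s q"
proof (erule Dgen_invariant_imp_Deq_invariant)
  fix p q
  assume "(p, q) \<in> Dgen S \<alpha>"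
  then show "act_val s p = act_val s q"
  proof (cases rule: Dgen_cases)
    case (delta t x)
    then show ?thesis
      by (simp add: act_val_def)
  next
    case (star t u x)
    show ?thesis
    \<comment> \<open>If \<open>s\<close> and \<open>t\<close> compose, associativity and relation
      (2) for the pair \<open>star S s t\<close>, \<open>u\<close> give equality. Otherwise
      \<open>s\<close> does not compose with \<open>star S t u\<close> either, so both values are
      determined by the common \<open>delta_val\<close>.\<close>
    proof (cases "(s, t) \<in> comps S")
      case True
      then have su: "(star S s t, u) \<in> comps S"
        using star by (simp add: comps_star_left_iff)
      have "act_val s p = Some (cls (Some (star S (star S s t) u), x))"
        using star True by (simp add: act_val_Some comps_star_right_iff star_assoc)
      also have "\<dots> = act_val s q"
        using star True cls_eqI[OF Deq_star[OF su]] by (simp add: act_val_Some)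
      finally show ?thesis .
    next
      case False
      then show ?thesis
        using star delta_val_star[OF star(3,4)] comps_star_right_iff[OF star(3)]
        by (simp add: act_val_def del: delta_val.simps split: option.split)
    qed
  qed
qed

section \<open>Domains and values of the action on classes\<close>

lemma Edom_cases [consumes 1, case_names Some None]:
  assumes "e \<in> Edom S \<alpha> X s"
  obtains t y where "e = cls (Some t, y)" "(s, t) \<in> comps S" "(Some t, y) \<in> D"
  | x where "e = cls (None, x)" "x \<in> rhoX S \<alpha> s"
  using assms by (auto simp: Edom_def Ddom_def mem_after_iff dest: cls_eqI)

lemma cls_Some_mem_Edom:
  assumes "(s, t) \<in> comps S" "(Some t, y) \<in> D"
  shows "cls (Some t, y) \<in> Edom S \<alpha> X s"
proof -
  have "((Some t, y), (Some t, y)) \<in> Deq S \<alpha> X"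
    using assms(2) equiv_Deq by (auto simp: equiv_def refl_on_def)
  then show ?thesis
    using assms unfolding Edom_def Ddom_def mem_after_iff by blast
qed

lemma cls_None_mem_Edom: "x \<in> rhoX S \<alpha> s \<Longrightarrow> cls (None, x) \<in> Edom S \<alpha> X s"
  by (auto simp: Edom_def Ddom_def)

text \<open>If \<open>(None, x)\<close> is equivalent to some \<open>(Some t, y)\<close> with
  \<open>t \<in> after S s\<close>, then \<open>act_val s\<close> is defined at the latter, hence at
  \<open>(None, x)\<close>, which means \<open>x \<in> rhoX S \<alpha> s\<close>.\<close>

lemma cls_None_mem_Edom_iff:
  assumes "x \<in> X"
  shows "cls (None, x) \<in> Edom S \<alpha> X s \<longleftrightarrow> x \<in> rhoX S \<alpha> s"
proof
  assume "cls (None, x) \<in> Edom S \<alpha> X s"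
  then show "x \<in> rhoX S \<alpha> s"
  proof (cases rule: Edom_cases)
    case (Some t y)
    then have "((None, x), (Some t, y)) \<in> Deq S \<alpha> X"
      using assms cls_eq_iff[of "(None, x)" "(Some t, y)"] by simp
    from act_val_Deq[OF this, of s] Some(2) show ?thesis
      by (simp add: act_val_Some split: if_splits)
  next
    case (None x')
    then have "((None, x), (None, x')) \<in> Deq S \<alpha> X"
      using assms cls_eq_iff[of "(None, x)" "(None, x')"] rhoX_subset by simp
    from delta_val_Deq[OF this] None(2) show ?thesis
      by simp
  qed
qed (rule cls_None_mem_Edom)

lemma Edom_subset: "Edom S \<alpha> X s \<subseteq> Eset S \<alpha> X"
  by (auto elim!: Edom_cases intro!: cls_mem_Eset simp: rhoX_subset)

text \<open>The element \<open>s\<close> enters \<open>Ddom\<close> only through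
  \<open>after S s\<close> and \<open>rhoX S \<alpha> s\<close>, both invariants of its
  R-class.\<close>

lemma Edom_R_rel:
  assumes "(s, t) \<in> R_rel S"
  shows "Edom S \<alpha> X s = Edom S \<alpha> X t"
  by (simp add: Edom_def Ddom_def R_rel_after[OF assms] rhoX_R_rel[OF assms])

text \<open>Each value prescribed by either clause of \<open>Eact\<close> equals
  \<open>act_val s\<close> at a representative of the class, and \<open>act_val s\<close> is
  constant on classes. This is the well-definedness of the action.\<close>

lemma Eact_eqI:
  assumes "p \<in> D" "cls p \<in> Edom S \<alpha> X s" "act_val s p = Some e"
  shows "Eact S \<alpha> X s (cls p) = e"
  unfolding Eact_def
proof (rule the_equality, goal_cases)
  case 1
  from assms(2) show ?case
  proof (cases rule: Edom_cases)
    case (Some t y)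
    then have "(p, (Some t, y)) \<in> Deq S \<alpha> X"
      using assms(1) cls_eq_iff by simp
    moreover from act_val_Deq[OF this, of s] assms(3) Some(2)
    have "e = cls (Some (star S s t), y)"
      by (simp add: act_val_Some)
    ultimately show ?thesis
      using Some assms(1) mem_after_iff by blast
  next
    case (None x)
    then have "(p, (None, x)) \<in> Deq S \<alpha> X"
      using assms(1) cls_eq_iff rhoX_subset by simp
    from act_val_Deq[OF this, of s] assms(3) None(2)
    have "e = cls (Some s, x)"
      by simp
    then show ?thesis
      using None by blast
  qed
next
  case (2 e')
  then show ?case
  proof (elim disjE exE bexE conjE)
    fix q t y
    assume q: "q \<in> D" "cls p = cls q" "(q, (Some t, y)) \<in> Deq S \<alpha> X"
      and t: "t \<in> after S s" and e': "e' = cls (Some (star S s t), y)"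
    have "(p, q) \<in> Deq S \<alpha> X"
      using assms(1) q cls_eq_iff by simp
    then have "act_val s p = act_val s (Some t, y)"
      using q act_val_Deq by metis
    with t e' assms(3) show "e' = e"
      by (simp add: act_val_Some mem_after_iff)
  next
    fix x
    assume x: "x \<in> rhoX S \<alpha> s" "cls p = cls (None, x)" and e': "e' = cls (Some s, x)"
    then have "(p, (None, x)) \<in> Deq S \<alpha> X"
      using assms(1) cls_eq_iff rhoX_subset by simp
    from act_val_Deq[OF this, of s] x e' assms(3) show "e' = e"
      by simp
  qed
qed

lemma Eact_Some:
  assumes "(s, t) \<in> comps S" "(Some t, y) \<in> D"
  shows "Eact S \<alpha> X s (cls (Some t, y)) = cls (Some (star S s t), y)"
  using assms by (intro Eact_eqI cls_Some_mem_Edom act_val_Some)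

lemma Eact_None:
  assumes "x \<in> rhoX S \<alpha> s"
  shows "Eact S \<alpha> X s (cls (None, x)) = cls (Some s, x)"
  using assms rhoX_subset by (intro Eact_eqI cls_None_mem_Edom) auto

lemma Eact_closed:
  assumes "s \<in> elems S" "e \<in> Edom S \<alpha> X s"
  shows "Eact S \<alpha> X s e \<in> Eset S \<alpha> X"
  using assms(2)
proof (cases rule: Edom_cases)
  case (Some t y)
  then show ?thesis
    using star_mem_D cls_mem_Eset by (simp add: Eact_Some del: Some_mem_D)
next
  case (None x)
  then show ?thesis
    using assms(1) cls_mem_Eset by (simp add: Eact_None)
qed

text \<open>On classes \<open>[r, y]\<close> this is associativity; on \<open>[\<delta>, x]\<close>
  both sides are \<open>[st, x]\<close>, as \<open>rhoX\<close> agrees at \<open>t\<close> and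
  \<open>st\<close>.\<close>

lemma Eact_mem_Edom_and_Eact_Eact:
  assumes st: "(s, t) \<in> comps S" and e: "e \<in> Edom S \<alpha> X t"
  shows "Eact S \<alpha> X t e \<in> Edom S \<alpha> X s \<and>
    Eact S \<alpha> X s (Eact S \<alpha> X t e) = Eact S \<alpha> X (star S s t) e"
  using e
proof (cases rule: Edom_cases)
  case (Some r y)
  have "(s, star S t r) \<in> comps S" "(star S s t, r) \<in> comps S"
    using st Some by (simp_all add: comps_star_left_iff comps_star_right_iff)
  then show ?thesis
    using st Some star_mem_D by (simp add: Eact_Some cls_Some_mem_Edom star_assoc del: Some_mem_D)
next
  case (None x)
  then show ?thesis
    using st by (simp add: Eact_None Eact_Some cls_Some_mem_Edom rhoX_star comps_elems)
qed

section \<open>The constructed action is global\<close>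

theorem global_action_Eaction: "global_action S (Eaction S \<alpha> X) (Eset S \<alpha> X)"
proof -
  have dom: "Edom S \<alpha> X (star S s t) = Edom S \<alpha> X t" if "(s, t) \<in> comps S" for s t
    using Edom_R_rel[OF R_rel_star[OF that]] .
  \<comment> \<open>This is the left-hand side of (P1); by \<open>dom\<close> the right-hand side is
    \<open>Edom S \<alpha> X t\<close> as well.\<close>
  have "{e \<in> Edom S \<alpha> X t. Eact S \<alpha> X t e \<in> Edom S \<alpha> X s \<inter> Eact S \<alpha> X t ` Edom S \<alpha> X t}
      = Edom S \<alpha> X t" if "(s, t) \<in> comps S" for s t
    using Eact_mem_Edom_and_Eact_Eact[OF that] by auto
  then have "partial_action S (Eaction S \<alpha> X) (Eset S \<alpha> X)"
    using Edom_subset Eact_closed Eact_mem_Edom_and_Eact_Eact dom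
    by (auto simp: partial_action_def Eaction_def prange_def)
  moreover have "Edom S \<alpha> X s = Edom S \<alpha> X t"
    if "s \<in> elems S" "t \<in> elems S" "after S s = after S t" "after S s \<noteq> {}" for s t
    using Edom_R_rel[OF R_rel_of_after_eq[OF that]] .
  ultimately show ?thesis
    using dom by (simp add: global_action_def Eaction_def split_beta) blast
qed

section \<open>The embedding of X\<close>

lemma action_morphism_iota:
  "action_morphism S \<alpha> X (Eaction S \<alpha> X) (Eset S \<alpha> X) (iota S \<alpha> X)"
  \<comment> \<open>Equivariance is relation (1):
    \<open>[\<delta>, \<alpha>\<^sub>s(x)] = [s, x]\<close>, and the right side is
    \<open>\<beta>\<^sub>s([\<delta>, x])\<close>.\<close>
  using cls_mem_Eset cls_None_mem_Edom pdom_subset_rhoX cls_eqI[OF Deq_delta]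
  by (auto simp: action_morphism_def iota_def Eaction_def Eact_None)

lemma inj_on_iota: "inj_on (iota S \<alpha> X) X"
proof (rule inj_onI)
  fix x y
  assume "x \<in> X" "y \<in> X" "iota S \<alpha> X x = iota S \<alpha> X y"
  then have "((None, x), (None, y)) \<in> Deq S \<alpha> X"
    by (simp add: iota_def flip: cls_eq_iff)
  from delta_val_Deq[OF this] show "x = y"
    by simp
qed

text \<open>The image of \<open>[\<delta>, x]\<close> is \<open>[s, x]\<close>. If that class
  contains some \<open>(None, z)\<close>, then \<open>delta_val (Some s, x) = Some z\<close>, which
  happens only for \<open>x \<in> pdom \<alpha> s\<close>.\<close>

lemma Eact_iota_mem_imp_mem_pdom:
  assumes s: "s \<in> elems S" and x: "x \<in> X" "iota S \<alpha> X x \<in> Edom S \<alpha> X s"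
    and e: "Eact S \<alpha> X s (iota S \<alpha> X x) \<in> iota S \<alpha> X ` X"
  shows "x \<in> pdom \<alpha> s"
proof -
  have rho: "x \<in> rhoX S \<alpha> s"
    using x cls_None_mem_Edom_iff by (simp add: iota_def)
  obtain z where "z \<in> X" "cls (Some s, x) = cls (None, z)"
    using e Eact_None[OF rho] by (auto simp: iota_def)
  then have "((Some s, x), (None, z)) \<in> Deq S \<alpha> X"
    using s rho by (simp flip: cls_eq_iff)
  from delta_val_Deq[OF this] show ?thesis
    by (simp split: if_splits)
qed

theorem globalization_Eaction:
  "globalization S \<alpha> X (iota S \<alpha> X) (Eaction S \<alpha> X) (Eset S \<alpha> X)"
proof -
  have "pdom \<alpha> s = {x \<in> X. iota S \<alpha> X x \<in> pdom (Eaction S \<alpha> X) s \<and>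
      pact (Eaction S \<alpha> X) s (iota S \<alpha> X x) \<in> iota S \<alpha> X ` X}" if s: "s \<in> elems S" for s
  proof safe
    fix x
    assume x: "x \<in> pdom \<alpha> s"
    show "x \<in> X"
      using pdom_subset[OF partial_action s x] .
    show "iota S \<alpha> X x \<in> pdom (Eaction S \<alpha> X) s"
      using morphism_pdom[OF action_morphism_iota s x] .
    show "pact (Eaction S \<alpha> X) s (iota S \<alpha> X x) \<in> iota S \<alpha> X ` X"
      using morphism_pact[OF action_morphism_iota s x] pact_closed[OF partial_action s x]
      by (metis imageI)
  qed (use Eact_iota_mem_imp_mem_pdom[OF s] in \<open>simp add: Eaction_def\<close>)
  then show ?thesis
    using global_action_Eaction action_morphism_iota inj_on_iota
    by (simp add: globalization_def action_embedding_def)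
qed

end

section \<open>The universal property\<close>

locale partial_sgpd_action_morphism = partial_sgpd_action S \<alpha> X
  for S :: "'s sgpd" and \<alpha> :: "('s, 'x) action" and X :: "'x set" +
  fixes \<theta> :: "('s, 'z) action" and Z :: "'z set" and \<phi> :: "'x \<Rightarrow> 'z"
  assumes global_action: "global_action S \<theta> Z" and morphism: "action_morphism S \<alpha> X \<theta> Z \<phi>"
begin

text \<open>For the first union, R-related elements have equal domains in a global action. For the
  second, \<open>\<phi>\<close> turns \<open>pact \<alpha> t y\<close> into
  \<open>pact \<theta> t (\<phi> y)\<close>, which lies in the domain of every \<open>s\<close>
  composable with \<open>t\<close>.\<close>

lemma morphism_rhoX:
  assumes "s \<in> elems S" "x \<in> rhoX S \<alpha> s"
  shows "\<phi> x \<in> pdom \<theta> s"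
  using assms(2) unfolding rhoX_def
proof safe
  fix t
  assume t: "(t, s) \<in> R_rel S" and x: "x \<in> pdom \<alpha> t"
  have "t \<in> elems S"
    using t equiv_R_rel by (auto simp: equiv_def refl_on_def)
  then show ?thesis
    using morphism_pdom[OF morphism _ x] global_action_R_rel_pdom[OF global_action t] by simp
next
  fix t
  assume "t \<in> after S s" and "x \<in> prange \<alpha> t"
  then obtain y where st: "(s, t) \<in> comps S" and y: "y \<in> pdom \<alpha> t" and x: "x = pact \<alpha> t y"
    by (auto simp: prange_def mem_after_iff)
  have t: "t \<in> elems S"
    using comps_elems[OF st] by simp
  show ?thesis
    using global_action_pact_mem[OF global_action st morphism_pdom[OF morphism t y]]
      morphism_pact[OF morphism t y] x by simp
qed

text \<open>These values are forced: a morphism extending \<open>\<phi>\<close> must send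
  \<open>[s, x] = \<beta>\<^sub>s([\<delta>, x])\<close> to
  \<open>pact \<theta> s (\<phi> x)\<close>.\<close>

fun lift_rep :: "'s option \<times> 'x \<Rightarrow> 'z" where
  "lift_rep (None, x) = \<phi> x"
| "lift_rep (Some s, x) = pact \<theta> s (\<phi> x)"

text \<open>Relation (1) is respected because \<open>\<phi>\<close> is equivariant, relation (2)
  because moreover \<open>star S t u\<close> acts on \<open>pdom \<theta> u\<close> as
  \<open>u\<close> followed by \<open>t\<close>.\<close>

lemma lift_rep_Deq: "(p, q) \<in> Deq S \<alpha> X \<Longrightarrow> lift_rep p = lift_rep q"
proof (erule Dgen_invariant_imp_Deq_invariant)
  fix p q
  assume "(p, q) \<in> Dgen S \<alpha>"
  then show "lift_rep p = lift_rep q"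
  proof (cases rule: Dgen_cases)
    case (delta s x)
    then show ?thesis
      using morphism_pact[OF morphism] by simp
  next
    case (star t u x)
    have u: "u \<in> elems S"
      using comps_elems[OF star(3)] by simp
    show ?thesis
      using star morphism_pact[OF morphism u star(4)]
        global_action_pact_star[OF global_action star(3) morphism_pdom[OF morphism u star(4)]]
      by simp
  qed
qed

lemma lift_rep_closed: "p \<in> D \<Longrightarrow> lift_rep p \<in> Z"
  using morphism_closed[OF morphism] morphism_rhoX
    pact_closed[OF global_action_imp_partial_action[OF global_action]]
  by (cases p rule: lift_rep.cases) auto

text \<open>The choice of representative is harmless by \<open>lift_rep_Deq\<close>; the restriction
  to \<open>Eset S \<alpha> X\<close> makes the function extensional, as the uniqueness statement
  demands.\<close>

definition lift :: "('s option \<times> 'x) set \<Rightarrow> 'z" where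
  "lift = (\<lambda>e \<in> Eset S \<alpha> X. lift_rep (SOME p. p \<in> D \<and> cls p = e))"

lemma lift_cls:
  assumes "p \<in> D"
  shows "lift (cls p) = lift_rep p"
proof -
  define q where "q = (SOME q. q \<in> D \<and> cls q = cls p)"
  have "q \<in> D \<and> cls q = cls p"
    unfolding q_def by (rule someI[of _ p]) (simp add: assms)
  then have "lift_rep q = lift_rep p"
    using assms cls_eq_iff lift_rep_Deq by blast
  then show ?thesis
    using cls_mem_Eset[OF assms] by (simp add: lift_def q_def)
qed

lemma action_morphism_lift: "action_morphism S (Eaction S \<alpha> X) (Eset S \<alpha> X) \<theta> Z lift"
proof -
  have "lift e \<in> pdom \<theta> s \<and> lift (Eact S \<alpha> X s e) = pact \<theta> s (lift e)"
    if s: "s \<in> elems S" and e: "e \<in> Edom S \<alpha> X s" for s e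
    using e
  proof (cases rule: Edom_cases)
    case (Some t y)
    then have "\<phi> y \<in> pdom \<theta> t"
      using morphism_rhoX by simp
    then show ?thesis
      \<comment> \<open>Both sides are values at \<open>\<phi> y\<close>: that of
        \<open>star S s t\<close> on the left, that of \<open>t\<close> and then \<open>s\<close> on
        the right.\<close>
      using Some star_mem_D global_action_pact_mem[OF global_action Some(2)]
        global_action_pact_star[OF global_action Some(2)]
      by (simp add: Eact_Some lift_cls del: Some_mem_D)
  next
    case (None x)
    then show ?thesis
      using s morphism_rhoX rhoX_subset by (simp add: Eact_None lift_cls)
  qed
  moreover have "lift \<in> Eset S \<alpha> X \<rightarrow> Z"
    using lift_cls lift_rep_closed by (auto simp: Eset_eq)
  ultimately show ?thesis
    by (auto simp: action_morphism_def Eaction_def)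
qed

text \<open>Every class is either \<open>[\<delta>, x]\<close>, where the value is
  \<open>\<phi> x\<close>, or \<open>[s, x] = \<beta>\<^sub>s([\<delta>, x])\<close>, where
  equivariance determines it.\<close>

lemma lift_unique:
  assumes \<Psi>: "\<Psi> \<in> extensional (Eset S \<alpha> X)"
    and mor: "action_morphism S (Eaction S \<alpha> X) (Eset S \<alpha> X) \<theta> Z \<Psi>"
    and iota: "\<forall>x \<in> X. \<Psi> (iota S \<alpha> X x) = \<phi> x"
  shows "\<Psi> = lift"
proof (rule extensionalityI[OF \<Psi>])
  show "lift \<in> extensional (Eset S \<alpha> X)"
    by (simp add: lift_def)
next
  fix e
  assume "e \<in> Eset S \<alpha> X"
  then obtain p where p: "p \<in> D" "e = cls p"
    by (auto simp: Eset_eq)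
  have "\<Psi> (cls p) = lift_rep p"
  proof (cases p rule: lift_rep.cases)
    case (1 x)
    then show ?thesis
      using p iota by (simp add: iota_def)
  next
    case (2 s x)
    then have s: "s \<in> elems S" and x: "x \<in> rhoX S \<alpha> s"
      using p by auto
    have "\<Psi> (Eact S \<alpha> X s (cls (None, x))) = pact \<theta> s (\<Psi> (cls (None, x)))"
      using morphism_pact[OF mor s, of "cls (None, x)"] cls_None_mem_Edom[OF x]
      by (simp add: Eaction_def)
    then show ?thesis
      using 2 iota rhoX_subset[OF x] by (simp add: Eact_None[OF x] iota_def)
  qed
  then show "\<Psi> e = lift e"
    using p lift_cls by simp
qed

theorem ex1_lift:
  "\<exists>!\<Phi>. \<Phi> \<in> extensional (Eset S \<alpha> X) \<and> action_morphism S (Eaction S \<alpha> X) (Eset S \<alpha> X) \<theta> Z \<Phi> \<and>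
     (\<forall>x \<in> X. \<Phi> (iota S \<alpha> X x) = \<phi> x)"
proof (rule ex1I[of _ lift])
  show "lift \<in> extensional (Eset S \<alpha> X) \<and>
      action_morphism S (Eaction S \<alpha> X) (Eset S \<alpha> X) \<theta> Z lift \<and>
      (\<forall>x \<in> X. lift (iota S \<alpha> X x) = \<phi> x)"
    using action_morphism_lift by (simp add: iota_def lift_cls) (simp add: lift_def)
qed (use lift_unique in blast)

end

theorem theorem3p7:
  fixes S :: "'s sgpd" and \<alpha> :: "('s, 'x) action" and X :: "'x set"
  assumes "semigroupoid S"
    and "partial_action S \<alpha> X"
  shows "global_action S (Eaction S \<alpha> X) (Eset S \<alpha> X) \<and>
         universal_globalization TYPE('z) S \<alpha> X (iota S \<alpha> X) (Eaction S \<alpha> X) (Eset S \<alpha> X)"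
proof -
  interpret partial_sgpd_action S \<alpha> X
    using assms by unfold_locales
  have "\<exists>!\<Phi>. \<Phi> \<in> extensional (Eset S \<alpha> X) \<and>
      action_morphism S (Eaction S \<alpha> X) (Eset S \<alpha> X) \<theta> Z \<Phi> \<and>
      (\<forall>x \<in> X. \<Phi> (iota S \<alpha> X x) = \<phi> x)"
    if "global_action S \<theta> Z" "action_morphism S \<alpha> X \<theta> Z \<phi>"
    for \<theta> :: "('s, 'z) action" and Z :: "'z set" and \<phi>
  proof -
    interpret partial_sgpd_action_morphism S \<alpha> X \<theta> Z \<phi>
      using that by unfold_locales
    show ?thesis
      by (rule ex1_lift)
  qed
  then show ?thesis
    using global_action_Eaction globalization_Eaction
    by (simp add: universal_globalization_def)
qed

end
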